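(* For every integer $n\ge 0$, \begin{align*} H_{7n}(F(x,7))&=H_{7n+1}(F(x,7))=(-1)^n, \\ H_{7n+2}(F(x,7))&=(-1)^n\,\tfrac76 ( n+1 )( 98n^{2}+49n-12 ),\\ H_{7n+3}(F(x,7))&=-H_{7n+5}(F(x,7))=-(-1)^n\left(7(n+1)\right)^2,\\ H_{7n+4}(F(x,7))&=0,\\ H_{7n+6}(F(x,7))&=(-1)^n\,\tfrac76 ( n+1 )( 98n^{2}+343n+282 ). \end{align*}
   Context: For a power series $A(x)=\sum_{n\ge 0}a_nx^n$, the Hankel determinants are $H_n(A(x))=\det(a_{i+j})_{0\le i,j\le n-1}$ for $n\ge 1$, with $H_0(A(x))=1$. Let $C(x)=\sum_{n\ge0}C_nx^n$ with $C_n=\frac1{n+1}\binom{2n}{n}$ be the Catalan generating function (the unique power series with $C(x)=1+xC(x)^2$), and $F(x,r)=C(x)^r=\sum_{n\ge 0}\frac{r}{2n+r}\binom{2n+r}{n}x^n$ for positive integers $r$. *)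

theory Defs
  imports
    "HOL-Computational_Algebra.Formal_Power_Series"
    "Jordan_Normal_Form.Determinant"
begin

(* For n = 0 this is the determinant of the empty matrix, which is 1. *)
definition hankel_det :: "nat \<Rightarrow> 'a::comm_ring_1 fps \<Rightarrow> 'a" where
  "hankel_det n A = det (mat n n (\<lambda>(i, j). fps_nth A (i + j)))"

lemma hankel_det_0: "hankel_det 0 A = 1"
  by (simp add: hankel_det_def)

definition catalan_fps :: "rat fps" where
  "catalan_fps = Abs_fps (\<lambda>n. 1 / of_nat (n + 1) * of_nat ((2 * n) choose n))"

definition catalan_power :: "nat \<Rightarrow> rat fps" where
  "catalan_power r = catalan_fps ^ r"

end

theory Submission
  imports Defs
begin

text \<open>
  Put \<open>t = z + 2 + 1/z\<close> and \<open>p\<^sub>k = z\<^sup>-\<^sup>k + \<dots> + z\<^sup>k\<close>, a monic polynomial of degree \<open>k\<close> in \<open>t\<close>. The linear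
  functional \<open>L\<close> on polynomials in \<open>t\<close> whose moments \<open>L(t\<^sup>n)\<close> are the Catalan numbers has the \<open>p\<^sub>k\<close>
  as its orthonormal polynomials, and the coordinates of \<open>t\<^sup>i\<close> in this basis are ballot numbers,
  which are also the coefficients of the odd powers of \<open>C(x)\<close>. In particular the coefficients of
  \<open>C(x)\<^sup>7\<close> are the moments \<open>L(Q t\<^sup>n)\<close> of the modified functional with weight
  \<open>Q = t\<^sup>3 p\<^sub>3 = t\<^sup>6 - 5 t\<^sup>5 + 6 t\<^sup>4 - t\<^sup>3\<close>.

  Christoffel's principle now trades the \<open>n \<times> n\<close> Hankel determinant for a \<open>6 \<times> 6\<close> determinant: if
  \<open>\<phi>\<^sub>0, \<dots>, \<phi>\<^sub>5\<close> is a basis of the functionals that vanish on the multiples of \<open>Q\<close>, then the Hankel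
  determinant is the quotient of the determinants of \<open>\<phi>\<^sub>c(p\<^bsub>n+j\<^esub>)\<close> and of \<open>\<phi>\<^sub>c(p\<^sub>j)\<close>, where
  \<open>j, c < 6\<close> (theorem \<open>det_modified_hankel\<close>; only the sequences \<open>\<phi>\<^sub>c(p\<^sub>k)\<close> of values occur there).

  For this \<open>Q\<close> the functionals are explicit. Three of them come from the roots of \<open>p\<^sub>3\<close>, where \<open>z\<close> is
  a nontrivial seventh root of unity; on these \<open>p\<^sub>k\<close> has period 7 in \<open>k\<close>, which is why the answer
  depends on the residue modulo 7. The other three come from the triple root \<open>t = 0\<close>, where
  \<open>z = -1\<close> and the values are \<open>(-1)\<^sup>k\<close> times polynomials in \<open>k(k + 1)\<close>; these give the sign \<open>(-1)\<^sup>n\<close>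
  and the polynomial growth. What remains is the evaluation of a \<open>6 \<times> 6\<close> determinant with three very
  sparse columns, once for every residue class (lemma \<open>window_det_values\<close>).
\<close>

section \<open>The functional equation of the Catalan series\<close>

lemma catalan_fps_nth_Suc:
  "of_nat (n + 2) * fps_nth catalan_fps (Suc n) = of_nat (4 * n + 2) * fps_nth catalan_fps n"
proof -
  have "Suc n * (2 * Suc n choose Suc n) = 2 * (Suc n * (Suc (2 * n) choose n))"
    using Suc_times_binomial_eq[of "Suc (2 * n)" n] by (simp add: mult.commute)
  also have "Suc n * (Suc (2 * n) choose n) = (2 * n + 1) * (2 * n choose n)"
    using Suc_times_binomial_eq[of "2 * n" n] binomial_symmetric[of n "Suc (2 * n)"]
    by (simp add: mult.commute)
  finally have "Suc n * (2 * Suc n choose Suc n) = 2 * ((2 * n + 1) * (2 * n choose n))" .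
  hence "of_nat (Suc n) * (of_nat (2 * Suc n choose Suc n) :: rat)
      = 2 * ((2 * of_nat n + 1) * of_nat (2 * n choose n))"
    by (metis (mono_tags, lifting) of_nat_1 of_nat_add of_nat_mult of_nat_numeral)
  thus ?thesis
    by (simp add: catalan_fps_def field_simps del: binomial_Suc_Suc mult_Suc_right)
qed

text \<open>
  Multiplying out, the equation says that \<open>Y = 1 - 2 x C\<close> is a square root of \<open>1 - 4 x\<close>. The two-term
  recurrence of the Catalan numbers is the differential equation \<open>(1 - 4 x) Y' = - 2 Y\<close>, hence
  \<open>(1 - 4 x) Z' = - 4 Z\<close> for \<open>Z = Y\<^sup>2\<close>, and the recurrence that this gives for the coefficients of \<open>Z\<close>
  breaks off after the linear term.
\<close>

lemma catalan_fps_eq: "catalan_fps = 1 + fps_X * catalan_fps ^ 2"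
proof -
  define Y where "Y = 1 - fps_const 2 * (fps_X * catalan_fps)"
  have mult_nth: "fps_nth ((1 - fps_const 4 * fps_X) * f) n
      = fps_nth f n - 4 * (if n = 0 then 0 else fps_nth f (n - 1))" for f :: "rat fps" and n
    by (simp add: left_diff_distrib mult.assoc)
  have Y_nth: "fps_nth Y n = (if n = 0 then 1 else - 2 * fps_nth catalan_fps (n - 1))" for n
    by (simp add: Y_def)
  have ode: "(1 - fps_const 4 * fps_X) * fps_deriv Y = fps_const (- 2) * Y"
  proof (rule fps_ext)
    fix n
    show "fps_nth ((1 - fps_const 4 * fps_X) * fps_deriv Y) n = fps_nth (fps_const (- 2) * Y) n"
    proof (cases n)
      case 0
      thus ?thesis by (simp add: mult_nth Y_nth) (simp add: catalan_fps_def)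
    next
      case (Suc m)
      thus ?thesis using catalan_fps_nth_Suc[of m]
        by (simp add: mult_nth Y_nth algebra_simps)
    qed
  qed
  define Z where "Z = Y * Y"
  have "(1 - fps_const 4 * fps_X) * fps_deriv Z = 2 * (Y * ((1 - fps_const 4 * fps_X) * fps_deriv Y))"
    by (simp add: Z_def algebra_simps)
  also have "\<dots> = fps_const (- 4) * Z"
  proof -
    have "fps_const (- 4 :: rat) = 2 * fps_const (- 2)" by (simp add: numeral_fps_const)
    thus ?thesis unfolding ode Z_def by (simp only: ac_simps)
  qed
  finally have ode_Z: "fps_nth ((1 - fps_const 4 * fps_X) * fps_deriv Z) n = - 4 * fps_nth Z n" for n
    by simp
  have rec: "of_nat (n + 1) * fps_nth Z (n + 1) = 4 * (of_nat n - 1) * fps_nth Z n" for n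
    using ode_Z[of n, unfolded mult_nth] by (cases n) (simp_all add: algebra_simps)
  have Z0: "fps_nth Z 0 = 1" by (simp add: Z_def Y_nth)
  have Z1: "fps_nth Z 1 = -4" using rec[of 0] Z0 by simp
  have Z2: "fps_nth Z (n + 2) = 0" for n
  proof (induction n)
    case 0
    show ?case using rec[of 1] by simp
  next
    case (Suc n)
    have "of_nat (n + 3) * fps_nth Z (n + 3) = 0"
      using rec[of "n + 2"] Suc by (simp add: numeral_eq_Suc)
    moreover have "of_nat (n + 3) \<noteq> (0 :: rat)" by (simp only: of_nat_eq_0_iff)
    ultimately show ?case by (simp add: numeral_eq_Suc)
  qed
  have Z: "Z = 1 - fps_const 4 * fps_X"
  proof (rule fps_ext)
    fix n :: nat
    consider "n = 0" | "n = 1" | m where "n = m + 2"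
      by (metis One_nat_def add_2_eq_Suc' not0_implies_Suc)
    thus "fps_nth Z n = fps_nth (1 - fps_const 4 * fps_X) n"
      by cases (simp_all only: Z0 Z1 Z2, simp_all)
  qed
  have "(fps_const 4 * fps_X) * (1 + fps_X * catalan_fps ^ 2 - catalan_fps)
      = Z - (1 - fps_const 4 * fps_X)"
  proof -
    have "fps_const 4 = (4 :: rat fps)" "fps_const 2 = (2 :: rat fps)"
      by (simp_all add: numeral_fps_const)
    thus ?thesis by (simp add: Z_def Y_def power2_eq_square algebra_simps)
  qed
  hence "(fps_const 4 * fps_X) * (1 + fps_X * catalan_fps ^ 2 - catalan_fps) = 0"
    by (simp add: Z)
  moreover have "(fps_const 4 * fps_X :: rat fps) \<noteq> 0" by simp
  ultimately show ?thesis by simp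
qed

section \<open>Ballot numbers\<close>

text \<open>
  Multiplication by \<open>t = z + 2 + 1/z\<close> on Laurent coefficients, and also on coordinates in the basis
  \<open>p\<^sub>k\<close>: since \<open>t p\<^sub>k = p\<^bsub>k-1\<^esub> + 2 p\<^sub>k + p\<^bsub>k+1\<^esub>\<close> holds for \<open>k = 0\<close> with \<open>p\<^bsub>-1\<^esub> = - p\<^sub>0\<close>, sequences are
  continued to negative indices by oddness about \<open>-1/2\<close>, which makes the boundary row of the
  operator look like all the others.
\<close>

definition tridiag :: "(int \<Rightarrow> 'a::comm_ring_1) \<Rightarrow> int \<Rightarrow> 'a" where
  "tridiag u k = u (k - 1) + 2 * u k + u (k + 1)"

definition reflection_odd :: "(int \<Rightarrow> 'a::comm_ring_1) \<Rightarrow> bool" where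
  "reflection_odd u \<longleftrightarrow> (\<forall>k. u (- 1 - k) = - u k)"

text \<open>The coordinate of \<open>t\<^sup>i\<close> at \<open>p\<^sub>k\<close>, continued oddly; at \<open>k = 0\<close> it is the Catalan moment \<open>L(t\<^sup>i)\<close>.\<close>

definition ballot :: "nat \<Rightarrow> int \<Rightarrow> 'a::comm_ring_1" where
  "ballot i = (tridiag ^^ i) (\<lambda>k. if k = 0 then 1 else if k = - 1 then - 1 else 0)"

lemma ballot_0: "ballot 0 k = (if k = 0 then 1 else if k = - 1 then - 1 else 0)"
  by (simp add: ballot_def)

lemma ballot_Suc: "ballot (Suc i) = tridiag (ballot i)"
  by (simp add: ballot_def)

lemma tridiag_funpow_ballot: "(tridiag ^^ i) (ballot j) = ballot (i + j)"
  by (simp add: ballot_def funpow_add)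

lemma reflection_oddD: "reflection_odd u \<Longrightarrow> u (- 1 - k) = - u k"
  by (simp add: reflection_odd_def)

lemma reflection_odd_tridiag:
  assumes "reflection_odd u"
  shows "reflection_odd (tridiag u)"
  unfolding reflection_odd_def tridiag_def
proof
  fix k
  show "u (- 1 - k - 1) + 2 * u (- 1 - k) + u (- 1 - k + 1) = - (u (k - 1) + 2 * u k + u (k + 1))"
    using reflection_oddD[OF assms, of "k + 1"] reflection_oddD[OF assms, of k]
      reflection_oddD[OF assms, of "k - 1"]
    by (simp add: algebra_simps)
qed

lemma reflection_odd_ballot: "reflection_odd (ballot i)"
proof (induction i)
  case 0
  show ?case by (auto simp: reflection_odd_def ballot_0)
next
  case (Suc i)
  thus ?case by (simp add: ballot_Suc reflection_odd_tridiag)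
qed

lemma ballot_eq_0: "k > int i \<Longrightarrow> ballot i k = 0"
  by (induction i arbitrary: k) (simp_all add: ballot_0 ballot_Suc tridiag_def)

lemma ballot_diag: "ballot i (int i) = 1"
  by (induction i) (simp_all add: ballot_0 ballot_Suc tridiag_def ballot_eq_0)

text \<open>
  The operator is symmetric, so the difference telescopes. The contribution of the lower boundary
  is zero because both sequences are odd.
\<close>

lemma sum_tridiag_adjoint:
  assumes f: "reflection_odd f" and g: "reflection_odd g"
  shows "(\<Sum>k<N. tridiag f (int k) * g (int k)) - (\<Sum>k<N. f (int k) * tridiag g (int k))
    = f (int N) * g (int N - 1) - f (int N - 1) * g (int N)"
proof (induction N)
  case 0
  show ?case using reflection_oddD[OF f, of 0] reflection_oddD[OF g, of 0] by simp
next
  case (Suc N)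
  thus ?case by (simp add: tridiag_def algebra_simps)
qed

text \<open>
  If \<open>u\<close> lists the values \<open>\<phi>(p\<^sub>k)\<close> of a linear functional, the left-hand side is \<open>\<phi>(t\<^sup>i)\<close>; the identity
  then says that multiplication by \<open>t\<close> inside \<open>\<phi>\<close> is the operator \<open>tridiag\<close> on values. Taking for \<open>u\<close> a
  ballot sequence gives the orthonormality of the \<open>p\<^sub>k\<close>.
\<close>

lemma sum_ballot_mult:
  assumes "reflection_odd u" "i < N"
  shows "(\<Sum>k<N. ballot i (int k) * u (int k)) = (tridiag ^^ i) u 0"
  using assms
proof (induction i arbitrary: u)
  case 0
  have "(\<Sum>k<N. ballot 0 (int k) * u (int k)) = (\<Sum>k<N. if k = 0 then u 0 else 0)"
    by (intro sum.cong) (auto simp: ballot_0)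
  thus ?case using 0 by simp
next
  case (Suc i)
  have "(\<Sum>k<N. ballot (Suc i) (int k) * u (int k))
      = (\<Sum>k<N. ballot i (int k) * tridiag u (int k))
        + (ballot i (int N) * u (int N - 1) - ballot i (int N - 1) * u (int N))"
    using sum_tridiag_adjoint[OF reflection_odd_ballot[of i] Suc.prems(1), of N]
    by (simp add: ballot_Suc algebra_simps)
  also have "\<dots> = (\<Sum>k<N. ballot i (int k) * tridiag u (int k))"
    using Suc.prems by (simp add: ballot_eq_0)
  also have "\<dots> = (tridiag ^^ i) (tridiag u) 0"
    using Suc by (simp add: reflection_odd_tridiag)
  finally show ?case by (simp add: funpow_swap1)
qed

text \<open>
  The series \<open>E\<^sub>l = x\<^sup>l C\<^bsup>2l+1\<^esup>\<close> obey the recursion of the ballot numbers: two factors \<open>C\<close> of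
  \<open>E\<^sub>l\<close> are replaced by \<open>1 + x C\<^sup>2\<close>, which gives \<open>E\<^sub>l = x (E\<^bsub>l-1\<^esub> + 2 E\<^sub>l + E\<^bsub>l+1\<^esub>)\<close>, and for \<open>l = 0\<close> the same
  replacement gives \<open>E\<^sub>0 = 1 + x (E\<^sub>0 + E\<^sub>1)\<close>.
\<close>

lemma ballot_eq_fps_nth:
  "ballot m (int l) = fps_nth (fps_X ^ l * catalan_fps ^ (2 * l + 1)) m"
proof (induction m arbitrary: l)
  case 0
  show ?case by (cases l) (simp_all add: ballot_0 catalan_fps_def)
next
  case (Suc m)
  let ?C = catalan_fps
  let ?E = "\<lambda>l. fps_X ^ l * ?C ^ (2 * l + 1)"
  show ?case
  proof (cases l)
    case 0
    have "?C = 1 + fps_X * (?C * (1 + fps_X * ?C ^ 2))"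
      using catalan_fps_eq by (simp add: power2_eq_square)
    also have "\<dots> = 1 + fps_X * (?E 0 + ?E 1)"
      by (simp add: algebra_simps power2_eq_square numeral_3_eq_3)
    finally have "?E 0 = 1 + fps_X * (?E 0 + ?E 1)" by simp
    hence "fps_nth (?E 0) (Suc m) = fps_nth (1 + fps_X * (?E 0 + ?E 1)) (Suc m)"
      by (rule arg_cong)
    also have "\<dots> = fps_nth (?E 0 + ?E 1) m" by simp
    finally have "fps_nth (?E 0) (Suc m) = fps_nth (?E 0 + ?E 1) m" .
    moreover have "ballot m (- 1) = - (ballot m 0 :: rat)"
      using reflection_oddD[OF reflection_odd_ballot, of m 0] by simp
    ultimately show ?thesis
      using Suc.IH[of 0] Suc.IH[of 1] 0 by (simp add: ballot_Suc tridiag_def)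
  next
    case (Suc k)
    have "?E l = fps_X ^ l * ?C ^ (2 * k + 1) * (1 + fps_X * ?C ^ 2) ^ 2"
      using catalan_fps_eq Suc by (simp add: power2_eq_square mult.assoc)
    also have "\<dots> = fps_X * (?E k + 2 * ?E (k + 1) + ?E (k + 2))"
      using Suc by (simp add: power2_eq_square algebra_simps)
    finally have "fps_nth (?E l) (Suc m) = fps_nth (?E k + 2 * ?E (k + 1) + ?E (k + 2)) m"
      by (simp only: fps_X_mult_nth) simp
    thus ?thesis using Suc.IH[of k] Suc.IH[of "k + 1"] Suc.IH[of "k + 2"] Suc
      by (simp add: ballot_Suc tridiag_def numeral_fps_const add.commute)
  qed
qed

section \<open>Christoffel's principle for Hankel determinants\<close>

text \<open>
  Let \<open>Q = \<Sum>\<^sub>m q\<^sub>m t\<^sup>m\<close>. The matrix \<open>A\<close> of the proof lists the coordinates of \<open>Q t\<^sup>i\<close> in the rows below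
  \<open>d\<close> unit rows. It is lower unitriangular as \<open>Q\<close> is monic of degree \<open>d\<close>. It annihilates the
  columns \<open>u\<^sub>c\<close>, apart from the unit rows, and by orthonormality it turns the coordinates of \<open>t\<^sup>c\<close> into the
  moments \<open>L(Q t\<^bsup>i+c\<^esup>)\<close>. So when \<open>X\<close> collects the \<open>u\<^sub>c\<close> and the coordinates of
  \<open>1, \<dots>, t\<^bsup>n-1\<^esup>\<close>, the product \<open>A X\<close> is block triangular with the Hankel matrix as one diagonal block,
  and \<open>X\<close> itself is block triangular up to a permutation of its rows.
\<close>

theorem det_modified_hankel:
  fixes q :: "nat \<Rightarrow> 'a::idom"
  assumes monic: "q d = 1"
    and odd: "\<And>c. c < d \<Longrightarrow> reflection_odd (u c)"
    and kernel: "\<And>c k. c < d \<Longrightarrow> (\<Sum>m\<le>d. q m * (tridiag ^^ m) (u c) k) = 0"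
  shows "det (mat d d (\<lambda>(j, c). u c (int j)))
        * det (mat n n (\<lambda>(i, j). \<Sum>m\<le>d. q m * ballot (i + j + m) 0))
    = (- 1) ^ (d * n) * det (mat d d (\<lambda>(j, c). u c (int (n + j))))"
proof -
  define G where "G i j = (\<Sum>m\<le>d. q m * ballot (i + m) (int j))" for i j
  have G_sum: "(\<Sum>j<n + d. G i j * v (int j)) = (\<Sum>m\<le>d. q m * (tridiag ^^ (i + m)) v 0)"
    if "i < n" "reflection_odd v" for i v
  proof -
    have "(\<Sum>j<n + d. G i j * v (int j))
        = (\<Sum>m\<le>d. q m * (\<Sum>j<n + d. ballot (i + m) (int j) * v (int j)))"
      unfolding G_def sum_distrib_left sum_distrib_right
      by (subst sum.swap) (simp add: mult.assoc)
    also have "\<dots> = (\<Sum>m\<le>d. q m * (tridiag ^^ (i + m)) v 0)"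
      using that by (intro sum.cong refl arg_cong2[of _ _ _ _ "(*)"] sum_ballot_mult) auto
    finally show ?thesis .
  qed
  have lin: "(tridiag ^^ i) (\<lambda>k. \<Sum>m\<le>d. q m * f m k) = (\<lambda>k. \<Sum>m\<le>d. q m * (tridiag ^^ i) (f m) k)"
    for i and f :: "nat \<Rightarrow> int \<Rightarrow> 'a"
    by (induction i) (simp_all add: tridiag_def fun_eq_iff sum.distrib sum_distrib_left algebra_simps)
  \<comment> \<open>The kernel condition at index \<open>k\<close> reads \<open>\<phi>\<^sub>c(Q p\<^sub>k) = 0\<close>; here it is passed on to \<open>\<phi>\<^sub>c(Q t\<^sup>i) = 0\<close>.\<close>
  have G_u: "(\<Sum>j<n + d. G i j * u c (int j)) = 0" if "i < n" "c < d" for i c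
  proof -
    have "(\<Sum>m\<le>d. q m * (tridiag ^^ (i + m)) (u c) 0)
        = (tridiag ^^ i) (\<lambda>k. \<Sum>m\<le>d. q m * (tridiag ^^ m) (u c) k) 0"
      by (simp add: lin funpow_add)
    also have "(\<lambda>k. \<Sum>m\<le>d. q m * (tridiag ^^ m) (u c) k) = (\<lambda>k. 0)"
      using kernel that by auto
    also have "(tridiag ^^ i) (\<lambda>k. 0 :: 'a) = (\<lambda>k. 0)"
      by (induction i) (simp_all add: tridiag_def fun_eq_iff)
    finally show ?thesis using G_sum[of i "u c"] odd that by simp
  qed
  have G_ballot: "(\<Sum>j<n + d. G i j * ballot c (int j)) = (\<Sum>m\<le>d. q m * ballot (i + c + m) 0)"
    if "i < n" for i c
    using G_sum[OF that reflection_odd_ballot, of c]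
    by (simp add: tridiag_funpow_ballot ac_simps)
  define A where "A = mat (n + d) (n + d)
    (\<lambda>(i, j). if i < d then if i = j then 1 else 0 else G (i - d) j)"
  define X where "X = mat (n + d) (n + d)
    (\<lambda>(j, c). if c < d then u c (int j) else ballot (c - d) (int j))"
  let ?U0 = "mat d d (\<lambda>(j, c). u c (int j))"
  let ?Un = "mat d d (\<lambda>(j, c). u c (int (n + j)))"
  let ?H = "mat n n (\<lambda>(i, j). \<Sum>m\<le>d. q m * ballot (i + j + m) 0)"
  let ?S = "mat n n (\<lambda>(j, c). ballot c (int j) :: 'a)"
  have A: "A \<in> carrier_mat (n + d) (n + d)" and X: "X \<in> carrier_mat (n + d) (n + d)"
    by (simp_all add: A_def X_def)
  have G_zero: "G i j = 0" if "i + d < j" for i j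
    using that by (simp add: G_def ballot_eq_0)
  have G_diag: "G i (i + d) = 1" for i
  proof -
    have "G i (i + d) = (\<Sum>m\<le>d. if m = d then 1 else 0)"
      unfolding G_def by (intro sum.cong refl) (use monic ballot_diag[of "i + d"] in \<open>auto simp: ballot_eq_0\<close>)
    thus ?thesis by simp
  qed
  have "det A = prod_list (diag_mat A)"
    by (rule det_lower_triangular[OF _ A]) (auto simp: A_def G_zero)
  also have "\<dots> = (\<Prod>i<n + d. A $$ (i, i))"
    using A by (simp add: prod_list_diag_prod atLeast0LessThan)
  also have "\<dots> = 1"
  proof (intro prod.neutral ballI)
    fix i assume "i \<in> {..<n + d}"
    thus "A $$ (i, i) = 1" using G_diag[of "i - d"] by (cases "i < d") (auto simp: A_def)
  qed
  finally have det_A: "det A = 1" .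
  have det_S: "det ?S = 1"
  proof -
    have "det ?S = prod_list (diag_mat ?S)"
      by (rule det_upper_triangular) (auto simp: upper_triangular_def ballot_eq_0)
    also have "\<dots> = 1" by (simp add: prod_list_diag_prod ballot_diag)
    finally show ?thesis .
  qed
  have AX: "A * X = four_block_mat ?U0 (mat d n (\<lambda>(j, c). ballot c (int j))) (0\<^sub>m n d) ?H"
  proof (rule eq_matI)
    fix i c
    assume "i < dim_row (four_block_mat ?U0 (mat d n (\<lambda>(j, c). ballot c (int j))) (0\<^sub>m n d) ?H)"
      "c < dim_col (four_block_mat ?U0 (mat d n (\<lambda>(j, c). ballot c (int j))) (0\<^sub>m n d) ?H)"
    hence i: "i < n + d" and c: "c < n + d" by auto
    have "(A * X) $$ (i, c) = (\<Sum>j<n + d. A $$ (i, j) * X $$ (j, c))"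
      using i c A X by (simp add: scalar_prod_def atLeast0LessThan)
    also have "\<dots> = four_block_mat ?U0 (mat d n (\<lambda>(j, c). ballot c (int j))) (0\<^sub>m n d) ?H $$ (i, c)"
    proof (cases "i < d")
      case True
      have "(\<Sum>j<n + d. A $$ (i, j) * X $$ (j, c)) = (\<Sum>j<n + d. if j = i then X $$ (i, c) else 0)"
        using i c True by (intro sum.cong) (auto simp: A_def)
      thus ?thesis using i c True by (simp add: X_def)
    next
      case False
      have "(\<Sum>j<n + d. A $$ (i, j) * X $$ (j, c))
          = (\<Sum>j<n + d. G (i - d) j * (if c < d then u c (int j) else ballot (c - d) (int j)))"
        using i c False by (intro sum.cong) (auto simp: A_def X_def)
      thus ?thesis using i c False by (cases "c < d") (simp_all add: G_u G_ballot)
    qed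
    finally show "(A * X) $$ (i, c)
      = four_block_mat ?U0 (mat d n (\<lambda>(j, c). ballot c (int j))) (0\<^sub>m n d) ?H $$ (i, c)" .
  qed (use A X in auto)
  \<comment> \<open>Moving the last \<open>d\<close> rows to the top makes \<open>X\<close> block triangular, since \<open>t\<^sup>c\<close> with \<open>c < n\<close> has no
    coordinates beyond \<open>n - 1\<close>.\<close>
  have "det X = (- 1) ^ (n * d) * det (mat (n + d) (n + d)
      (\<lambda>(i, j). X $$ (if i < d then i + n else if i < n + d then i - d else i, j)))"
    by (rule det_swap_initial_rows[OF X]) simp
  also have "mat (n + d) (n + d)
      (\<lambda>(i, j). X $$ (if i < d then i + n else if i < n + d then i - d else i, j))
    = four_block_mat ?Un (0\<^sub>m d n) (mat n d (\<lambda>(j, c). u c (int j))) ?S"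
    by (rule eq_matI) (auto simp: X_def ballot_eq_0 ac_simps)
  also have "det \<dots> = det ?Un"
    by (subst det_four_block_mat_upper_right_zero[of _ d _ n]) (auto simp: det_S)
  finally have det_X: "det X = (- 1) ^ (d * n) * det ?Un" by (simp add: mult.commute)
  have "det ?U0 * det ?H = det (A * X)"
    unfolding AX by (subst det_four_block_mat_lower_left_zero[of _ d _ n]) auto
  also have "\<dots> = (- 1) ^ (d * n) * det ?Un"
    by (simp add: det_mult[OF A X] det_A det_X)
  finally show ?thesis .
qed

section \<open>The weight of the seventh power and its kernel sequences\<close>

text \<open>The coefficients of \<open>Q = t\<^sup>3 p\<^sub>3\<close>; the name reflects that \<open>p\<^sub>3 = (z\<^sup>7 - 1) / (z\<^sup>3 (z - 1))\<close>.\<close>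

definition septic_coeff :: "nat \<Rightarrow> rat" where
  "septic_coeff m = [0, 0, 0, - 1, 6, - 5, 1] ! m"

text \<open>
  For \<open>c < 3\<close> these are the odd sequences of period 7 supported on the classes of \<open>c\<close> and \<open>6 - c\<close>; they
  combine the values of \<open>p\<^sub>k\<close> at the roots of \<open>p\<^sub>3\<close> so as to have integer entries. For \<open>c \<ge> 3\<close>
  they combine \<open>p\<^sub>k\<close> and its first two derivatives at \<open>t = 0\<close>: the factor \<open>(-1)\<^sup>k\<close> is odd under \<open>k \<mapsto> -1 - k\<close>,
  so the polynomial factor has to be invariant, that is, a polynomial in \<open>k (k + 1)\<close>.
\<close>

definition kernel_seq :: "nat \<Rightarrow> int \<Rightarrow> rat" where
  "kernel_seq c k =
    (if c < 3 then if k mod 7 = int c then 1 else if k mod 7 = 6 - int c then - 1 else 0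
     else (if even k then 1 else - 1) * of_int (k * (k + 1)) ^ (c - 3))"

text \<open>
  The right-hand side is \<open>p\<^sub>3 = t\<^sup>3 - 5 t\<^sup>2 + 6 t - 1\<close> applied to \<open>u\<close> at index 0: as an operator \<open>p\<^sub>3\<close> sums
  over the window from \<open>-3\<close> to \<open>3\<close>, and oddness cancels all terms except the last.
\<close>

lemma reflection_odd_at_3:
  assumes "reflection_odd u"
  shows "u 3 = (tridiag ^^ 3) u 0 - 5 * (tridiag ^^ 2) u 0 + 6 * tridiag u 0 - u 0"
  using reflection_oddD[OF assms, of 0] reflection_oddD[OF assms, of 1] reflection_oddD[OF assms, of 2]
  by (simp add: eval_nat_numeral tridiag_def)

lemma catalan_power_nth:
  "fps_nth (catalan_power 7) i = (\<Sum>m\<le>6. septic_coeff m * ballot (i + m) 0)"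
proof -
  have "fps_nth (catalan_power 7) i = ballot (i + 3) (int 3)"
    by (simp only: ballot_eq_fps_nth fps_X_power_mult_nth) (simp add: catalan_power_def)
  also have "\<dots> = ballot (i + 6) 0 - 5 * ballot (i + 5) 0 + 6 * ballot (i + 4) 0 - ballot (i + 3) 0"
    using reflection_odd_at_3[OF reflection_odd_ballot[where 'a = rat], of "i + 3"]
      tridiag_funpow_ballot[where 'a = rat, of 1 "i + 3"]
    by (simp add: tridiag_funpow_ballot add.commute)
  also have "\<dots> = (\<Sum>m\<le>6. septic_coeff m * ballot (i + m) 0)"
    by (simp add: septic_coeff_def eval_nat_numeral)
  finally show ?thesis .
qed

text \<open>
  The two factors of \<open>Q\<close> act as the window sum and as the cube of the operator, in either order. A
  sequence is therefore in the kernel as soon as one of the factors annihilates it.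
\<close>

lemma septic_tridiag:
  fixes k :: int
  shows "(\<Sum>m\<le>6. septic_coeff m * (tridiag ^^ m) u k) = (tridiag ^^ 3) (\<lambda>k. \<Sum>l\<in>{- 3..3}. u (k + l)) k"
    "(\<Sum>m\<le>6. septic_coeff m * (tridiag ^^ m) u k) = (\<Sum>l\<in>{- 3..3}. (tridiag ^^ 3) u (k + l))"
proof -
  have "{- 3..3::int} = {-3,-2,-1,0,1,2,3}" by auto
  thus "(\<Sum>m\<le>6. septic_coeff m * (tridiag ^^ m) u k) = (tridiag ^^ 3) (\<lambda>k. \<Sum>l\<in>{- 3..3}. u (k + l)) k"
    "(\<Sum>m\<le>6. septic_coeff m * (tridiag ^^ m) u k) = (\<Sum>l\<in>{- 3..3}. (tridiag ^^ 3) u (k + l))"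
    by (simp_all add: septic_coeff_def eval_nat_numeral tridiag_def algebra_simps)
qed

lemma reflection_odd_kernel_seq: "reflection_odd (kernel_seq c)"
  unfolding reflection_odd_def
proof
  fix k :: int
  have "(- 1 - k) mod 7 = 6 - k mod 7" by presburger
  thus "kernel_seq c (- 1 - k) = - kernel_seq c k"
    by (auto simp: kernel_seq_def algebra_simps)
qed

text \<open>
  On \<open>(-1)\<^sup>k f(k)\<close> the operator is minus the second difference of \<open>f\<close>, so its cube is a sixth
  difference, which kills polynomials of degree at most 5.
\<close>

lemma tridiag_pow_3_alternating:
  fixes f :: "int \<Rightarrow> rat"
  shows "(tridiag ^^ 3) (\<lambda>k. (if even k then 1 else - 1) * f k) k = (if even k then 1 else - 1) *
    (20 * f k - 15 * (f (k - 1) + f (k + 1)) + 6 * (f (k - 2) + f (k + 2)) - (f (k - 3) + f (k + 3)))"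
  by (cases "even k") (simp_all add: numeral_3_eq_3 tridiag_def ac_simps)

lemma kernel_seq_kernel:
  assumes "c < 6"
  shows "(\<Sum>m\<le>6. septic_coeff m * (tridiag ^^ m) (kernel_seq c) k) = 0"
proof (cases "c < 3")
  case True
  have "(\<Sum>l\<in>{- 3..3}. kernel_seq c (k + l)) = 0" for k :: int
  proof -
    define r where "r = k mod 7"
    have "kernel_seq c (k + l) = kernel_seq c (r + l)" for l
      using True by (simp add: kernel_seq_def r_def mod_simps)
    moreover have "{- 3..3::int} = {-3,-2,-1,0,1,2,3}" by auto
    moreover have "r \<in> {0, 1, 2, 3, 4, 5, 6}"
      unfolding r_def by simp presburger
    moreover have "c \<in> {0, 1, 2}" using True by auto
    ultimately show ?thesis by (elim insertE emptyE) (simp_all add: kernel_seq_def)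
  qed
  thus ?thesis unfolding septic_tridiag(1) by (simp add: numeral_3_eq_3 tridiag_def)
next
  case False
  have "(tridiag ^^ 3) (kernel_seq c) k = 0" for k
  proof -
    define f :: "int \<Rightarrow> rat" where "f k = of_int (k * (k + 1)) ^ (c - 3)" for k
    have "kernel_seq c = (\<lambda>k. (if even k then 1 else - 1) * f k)"
      using False by (simp add: kernel_seq_def f_def fun_eq_iff)
    moreover have "c \<in> {3, 4, 5}" using False assms by auto
    hence "20 * f k - 15 * (f (k - 1) + f (k + 1)) + 6 * (f (k - 2) + f (k + 2))
        - (f (k - 3) + f (k + 3)) = 0"
      by (elim insertE emptyE) (simp_all add: f_def power2_eq_square algebra_simps)
    ultimately show ?thesis by (simp only: tridiag_pow_3_alternating mult_zero_right)
  qed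
  thus ?thesis unfolding septic_tridiag(2) by simp
qed

abbreviation window_det :: "nat \<Rightarrow> rat" where
  "window_det n \<equiv> det (mat 6 6 (\<lambda>(j, c). kernel_seq c (int (n + j))))"

lemma window_det_0_mult_hankel_det:
  "window_det 0 * hankel_det n (catalan_power 7) = window_det n"
proof -
  have "septic_coeff 6 = 1" by (simp add: septic_coeff_def)
  from det_modified_hankel[of septic_coeff 6, OF this reflection_odd_kernel_seq kernel_seq_kernel, where n = n]
  show ?thesis by (simp add: hankel_det_def catalan_power_nth)
qed

section \<open>Evaluation of the six by six determinants\<close>

text \<open>
  Determinants of literal matrices, given by the list of rows. The expansion along the first column
  is stated once for each size, so that rewriting can eliminate one column at a time and drop the
  vanishing minors before they are expanded further.
\<close>

definition det_list :: "'a::comm_ring_1 list list \<Rightarrow> 'a" where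
  "det_list L = det (mat (length L) (length L) (\<lambda>(i, j). L ! i ! j))"

lemma det_list_first_column:
  assumes "L \<noteq> []" and "\<And>r. r \<in> set L \<Longrightarrow> length r = length L"
  shows "det_list L =
    (\<Sum>i<length L. (- 1) ^ i * (L ! i ! 0 * det_list (map tl (take i L @ drop (Suc i) L))))"
proof -
  let ?A = "mat (length L) (length L) (\<lambda>(i, j). L ! i ! j)"
  have "det_list L = (\<Sum>i<length L. ?A $$ (i, 0) * cofactor ?A i 0)"
    unfolding det_list_def using assms(1) by (intro laplace_expansion_column) auto
  also have "\<dots> = (\<Sum>i<length L. (- 1) ^ i * (L ! i ! 0 * det_list (map tl (take i L @ drop (Suc i) L))))"
  proof (intro sum.cong refl)
    fix i assume "i \<in> {..<length L}"
    hence i: "i < length L" by simp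
    let ?M = "map tl (take i L @ drop (Suc i) L)"
    have M: "length ?M = length L - 1" using i by simp
    have "mat_delete ?A i 0 = mat (length ?M) (length ?M) (\<lambda>(a, b). ?M ! a ! b)"
    proof (rule eq_matI)
      fix a b assume "a < dim_row (mat (length ?M) (length ?M) (\<lambda>(a, b). ?M ! a ! b))"
        "b < dim_col (mat (length ?M) (length ?M) (\<lambda>(a, b). ?M ! a ! b))"
      hence ab: "a < length L - 1" "b < length L - 1" using M by auto
      define a' where "a' = (if a < i then a else Suc a)"
      have a': "a' < length L" using ab i by (auto simp: a'_def)
      have "?M ! a = tl (L ! a')"
        using ab i by (auto simp: a'_def nth_append min_def)
      moreover have "length (L ! a') = length L" using a' assms(2) by simp
      ultimately have "?M ! a ! b = L ! a' ! Suc b" using ab by (simp add: nth_tl)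
      thus "mat_delete ?A i 0 $$ (a, b) = mat (length ?M) (length ?M) (\<lambda>(a, b). ?M ! a ! b) $$ (a, b)"
        using ab a' i M by (simp add: mat_delete_def a'_def)
    qed (use M in auto)
    thus "?A $$ (i, 0) * cofactor ?A i 0 = (- 1) ^ i * (L ! i ! 0 * det_list ?M)"
      using i assms(1) by (simp add: cofactor_def det_list_def)
  qed
  finally show ?thesis .
qed

lemma det_list_3:
  "det_list [[a1, a2, a3], [b1, b2, b3], [c1, c2, c3]] =
    a1 * (b2 * c3 - b3 * c2) - b1 * (a2 * c3 - a3 * c2) + c1 * (a2 * b3 - a3 * b2)"
proof -
  have 1: "det_list [[a]] = a" for a :: 'a
    unfolding det_list_def by (subst det_single) auto
  have 2: "det_list [[a, b], [c, d]] = a * d - b * c" for a b c d :: 'a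
    by (subst det_list_first_column) (auto simp: eval_nat_numeral algebra_simps 1)
  show ?thesis
    by (subst det_list_first_column) (auto simp: eval_nat_numeral algebra_simps 2)
qed

lemma det_list_4:
  assumes "length r0 = 3" "length r1 = 3" "length r2 = 3" "length r3 = 3"
  shows "det_list [a0 # r0, a1 # r1, a2 # r2, a3 # r3] =
    a0 * det_list [r1, r2, r3] - a1 * det_list [r0, r2, r3]
    + a2 * det_list [r0, r1, r3] - a3 * det_list [r0, r1, r2]"
  by (subst det_list_first_column) (use assms in \<open>auto simp: eval_nat_numeral algebra_simps\<close>)

lemma det_list_5:
  assumes "length r0 = 4" "length r1 = 4" "length r2 = 4" "length r3 = 4" "length r4 = 4"
  shows "det_list [a0 # r0, a1 # r1, a2 # r2, a3 # r3, a4 # r4] =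
    a0 * det_list [r1, r2, r3, r4] - a1 * det_list [r0, r2, r3, r4]
    + a2 * det_list [r0, r1, r3, r4] - a3 * det_list [r0, r1, r2, r4]
    + a4 * det_list [r0, r1, r2, r3]"
  by (subst det_list_first_column) (use assms in \<open>auto simp: eval_nat_numeral algebra_simps\<close>)

lemma det_list_6:
  assumes "length r0 = 5" "length r1 = 5" "length r2 = 5" "length r3 = 5" "length r4 = 5" "length r5 = 5"
  shows "det_list [a0 # r0, a1 # r1, a2 # r2, a3 # r3, a4 # r4, a5 # r5] =
    a0 * det_list [r1, r2, r3, r4, r5] - a1 * det_list [r0, r2, r3, r4, r5]
    + a2 * det_list [r0, r1, r3, r4, r5] - a3 * det_list [r0, r1, r2, r4, r5]
    + a4 * det_list [r0, r1, r2, r3, r5] - a5 * det_list [r0, r1, r2, r3, r4]"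
  by (subst det_list_first_column) (use assms in \<open>auto simp: eval_nat_numeral algebra_simps\<close>)

lemma window_det_eq_det_list:
  "window_det n = det_list (map (\<lambda>j. map (\<lambda>c. kernel_seq c (int (n + j)))
    [0, 1, 2, 3, 4, 5]) [0, 1, 2, 3, 4, 5])"
proof -
  have "[0, 1, 2, 3, 4, 5] = [0..<6]" by (simp add: upt_rec)
  moreover have "window_det n = det_list (map (\<lambda>j. map (\<lambda>c. kernel_seq c (int (n + j))) [0..<6]) [0..<6])"
    unfolding det_list_def by (intro arg_cong[of _ _ det] eq_matI) auto
  ultimately show ?thesis by (simp only:)
qed

text \<open>
  The periodic columns depend only on the residue class of the first row and have at most two
  nonzero entries each, so few minors survive; in the remaining columns the sign \<open>(-1)\<^sup>m\<close> is
  common to all entries and occurs three times.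
\<close>

lemma window_det_values:
  fixes m :: nat
  defines "x \<equiv> of_nat m"
  shows
    "window_det (7 * m) = 48 * (- 1) ^ m"
    "window_det (7 * m + 1) = 48 * (- 1) ^ m"
    "window_det (7 * m + 2) = (- 1) ^ m * 56 * (x + 1) * (98 * x ^ 2 + 49 * x - 12)"
    "window_det (7 * m + 3) = - ((- 1) ^ m) * 48 * (7 * (x + 1)) ^ 2"
    "window_det (7 * m + 4) = 0"
    "window_det (7 * m + 5) = (- 1) ^ m * 48 * (7 * (x + 1)) ^ 2"
    "window_det (7 * m + 6) = (- 1) ^ m * 56 * (x + 1) * (98 * x ^ 2 + 343 * x + 282)"
  unfolding window_det_eq_det_list x_def
  apply (case_tac [!] "even m")
  apply (simp_all add: kernel_seq_def)
  apply (simp_all add: det_list_6)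
  apply (simp_all add: det_list_5)
  apply (simp_all add: det_list_4)
  apply (simp_all add: det_list_3)
  apply (simp_all add: power2_eq_square algebra_simps)
  done

theorem theorem4:
  fixes n :: nat
  shows "hankel_det (7 * n) (catalan_power 7) = hankel_det (7 * n + 1) (catalan_power 7)
    \<and> hankel_det (7 * n + 1) (catalan_power 7) = (-1) ^ n
    \<and> hankel_det (7 * n + 2) (catalan_power 7)
        = (-1) ^ n * (7 / 6) * (of_nat n + 1) * (98 * of_nat n ^ 2 + 49 * of_nat n - 12)
    \<and> hankel_det (7 * n + 3) (catalan_power 7) = - hankel_det (7 * n + 5) (catalan_power 7)
    \<and> - hankel_det (7 * n + 5) (catalan_power 7) = - ((-1) ^ n) * (7 * (of_nat n + 1)) ^ 2
    \<and> hankel_det (7 * n + 4) (catalan_power 7) = 0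
    \<and> hankel_det (7 * n + 6) (catalan_power 7)
        = (-1) ^ n * (7 / 6) * (of_nat n + 1) * (98 * of_nat n ^ 2 + 343 * of_nat n + 282)"
proof -
  have "48 * hankel_det k (catalan_power 7) = window_det k" for k
    using window_det_0_mult_hankel_det[of k] window_det_values(1)[of 0] by simp
  hence *: "hankel_det k (catalan_power 7) = window_det k / 48" for k
    by (simp add: field_simps)
  show ?thesis unfolding * window_det_values by simp
qed

end
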